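(* Let $(\mu,\nu,\mathcal C)$ be a Gårding–Wightman triple on $X=\mathbb Z_2^\infty$ and $V=V(\mu,\nu,\mathcal C)$. If $\mu$ is discrete and $V$ is irreducible over $\mathbb C$, then $V(\mu,\nu,\mathcal C)$ admits no invariant quaternionic structure. In particular, the Fermi–Fock representation $V(\mu_\Delta,1,\{1\})$ is of complex type.
   Context: $X=\mathbb Z_2^{\infty}$ is the compact abelian group of sequences $x=(x_1,x_2,\dots)$ of $0$'s and $1$'s with componentwise addition mod $2$, the product topology and its Borel $\sigma$-algebra. $\delta^k\in X$ has a $1$ in position $k$ and $0$ elsewhere; $\Delta\subset X$ is the subgroup of sequences with finitely many $1$'s. A Gårding–Wightman triple $(\mu,\nu,\mathcal C)$ consists of: (1) a $\sigma$-finite positive Borel measure $\mu$ on $X$, quasi-invariant under $\Delta$, i.e. for each $\delta\in\Delta$ the measure $A\mapsto\mu(A+\delta)$ is mutually absolutely continuous with $\mu$; (2) a family $\{V_x\}_{x\in X}$ of nonzero separable complex Hilbert spaces with $V_{x+\delta}=V_x$ for $\delta\in\Delta$ and almost all $x$, and with $\nu(x)=\dim V_x$ measurable (up to unitary change, $V_x$ is a fixed model Hilbert space of dimension $\nu(x)$); (3) a family $\mathcal C=\{c_k(x):k\ge 1,x\in X\}$ of unitary operators $c_k(x):V_x\to V_{x+\delta^k}=V_x$, depending measurably on $x$, with $c_k(x)^*=c_k(x+\delta^k)$ and $c_k(x)c_l(x+\delta^k)=c_l(x)c_k(x+\delta^l)$ for all $k,l$ and almost all $x$. $V=V(\mu,\nu,\mathcal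 C)=\int_X^\oplus V_x\,d\mu(x)$ carries the mutually anticommuting unitary operators of square $-I$ ($k\ge1$) $$J_kf(x)=-i(-1)^{x_1+\dots+x_{k-1}}c_k(x)\sqrt{\tfrac{d\mu(x+\delta^k)}{d\mu(x)}}f(x+\delta^k),\quad J_k'f(x)=(-1)^{x_1+\dots+x_{k}}c_k(x)\sqrt{\tfrac{d\mu(x+\delta^k)}{d\mu(x)}}f(x+\delta^k),$$ where $d\mu(x+\delta^k)/d\mu(x)$ is the Radon–Nikodym derivative of $A\mapsto\mu(A+\delta^k)$ with respect to $\mu$; they define a representation of the Clifford algebra $C(H)$ of an infinite-dimensional separable real prehilbert space $H$. $\mu$ discrete means concentrated on a countable set of points. Irreducible over $\mathbb C$ means that $V\neq 0$ has no closed complex subspace, other than $0$ and $V$, invariant under all $J_k,J_k'$. An invariant real (resp. quaternionic) structure is a $\mathbb C$-antilinear norm-preserving operator on $V$ commuting with all $J_k,J_k'$ and with square $I$ (resp. $-I$). The representation is of complex type if it admits neither. $\mu_\Delta$ is the measure concentrated on $\Delta$ with $\mu_\Delta(\{\delta\})=1$ for each $\delta\in\Delta$; $V(\mu_\Delta,1,\{1\})$ is the case $V_x=\mathbb C$, $c_k(x)=1$. *)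

theory Defs
  imports "HOL-Analysis.Analysis"
begin

section \<open>The group of binary sequences\<close>

text \<open>A binary sequence is an element of \<^typ>\<open>nat \<Rightarrow> bool\<close>, with \<^const>\<open>True\<close> for the digit 1; the
  instance topology on \<^typ>\<open>nat \<Rightarrow> bool\<close> is the product of the discrete topologies, and \<^const>\<open>borel\<close>
  is its Borel \<open>\<sigma>\<close>-algebra. Positions are counted from 0, so position \<open>k\<close> here is the
  position \<open>k + 1\<close> of the sequence \<open>x\<^sub>1, x\<^sub>2, \<dots>\<close>.\<close>

type_synonym bseq = "nat \<Rightarrow> bool"

definition bplus :: "bseq \<Rightarrow> bseq \<Rightarrow> bseq" (infixl "\<oplus>\<^sub>2" 65)
  where "x \<oplus>\<^sub>2 y = (\<lambda>n. x n \<noteq> y n)"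

definition delta :: "nat \<Rightarrow> bseq"
  where "delta k = (\<lambda>n. n = k)"

definition Delta :: "bseq set"
  where "Delta = {x. finite {n. x n}}"

text \<open>Every \<open>d\<close> is its own inverse, so the preimage of \<open>A\<close> under addition of \<open>d\<close> is \<open>A + d\<close>, and the
  image measure below is \<open>A \<mapsto> \<mu>(A + d)\<close>.\<close>

definition translate :: "bseq \<Rightarrow> bseq measure \<Rightarrow> bseq measure"
  where "translate d M = distr M borel (\<lambda>x. x \<oplus>\<^sub>2 d)"

definition quasi_invariant :: "bseq measure \<Rightarrow> bool"
  where "quasi_invariant M \<longleftrightarrow>
    (\<forall>d\<in>Delta. absolutely_continuous M (translate d M) \<and> absolutely_continuous (translate d M) M)"


section \<open>Model Hilbert spaces\<close>

text \<open>The model Hilbert space of dimension \<open>n \<le> \<infinity>\<close> is the space of square-summable complex sequences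
  vanishing from index \<open>n\<close> on.\<close>

type_synonym cseq = "nat \<Rightarrow> complex"

definition hilb :: "enat \<Rightarrow> cseq set"
  where "hilb n = {v. (\<forall>i. n \<le> enat i \<longrightarrow> v i = 0) \<and> summable (\<lambda>i. (cmod (v i))\<^sup>2)}"

definition hinner :: "cseq \<Rightarrow> cseq \<Rightarrow> complex"
  where "hinner v w = (\<Sum>i. v i * cnj (w i))"

definition hbasis :: "nat \<Rightarrow> cseq"
  where "hbasis j = (\<lambda>i. if i = j then 1 else 0)"

definition hunitary :: "enat \<Rightarrow> (cseq \<Rightarrow> cseq) \<Rightarrow> bool"
  where "hunitary n U \<longleftrightarrow>
    U ` hilb n = hilb n \<and>
    (\<forall>v\<in>hilb n. \<forall>w\<in>hilb n. \<forall>a b.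
       U (\<lambda>i. a * v i + b * w i) = (\<lambda>i. a * U v i + b * U w i)) \<and>
    (\<forall>v\<in>hilb n. \<forall>w\<in>hilb n. hinner (U v) (U w) = hinner v w)"

definition hadjoint :: "enat \<Rightarrow> (cseq \<Rightarrow> cseq) \<Rightarrow> (cseq \<Rightarrow> cseq) \<Rightarrow> bool"
  where "hadjoint n U U' \<longleftrightarrow> (\<forall>v\<in>hilb n. \<forall>w\<in>hilb n. hinner (U v) w = hinner v (U' w))"


section \<open>Garding--Wightman triples\<close>

text \<open>The fibre over \<open>x\<close> is \<open>hilb (nu x)\<close>, so that \<open>V\<^bsub>x + d\<^esub> = V\<^bsub>x\<^esub>\<close> reads \<open>nu (x + d) = nu x\<close>.
  Outside a null set the fibres over \<open>x\<close> and \<open>x + delta k\<close> agree and \<open>c k x\<close> is a unitary operator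
  of that common fibre; on the null set nothing is demanded of the operators but the measurability
  of the matrix coefficients.\<close>

definition gw_triple ::
    "bseq measure \<Rightarrow> (bseq \<Rightarrow> enat) \<Rightarrow> (nat \<Rightarrow> bseq \<Rightarrow> cseq \<Rightarrow> cseq) \<Rightarrow> bool"
  where "gw_triple M nu c \<longleftrightarrow>
    sets M = sets borel \<and> sigma_finite_measure M \<and> quasi_invariant M \<and>
    nu \<in> borel \<rightarrow>\<^sub>M count_space UNIV \<and>
    (\<forall>x. nu x \<noteq> 0) \<and>
    (\<forall>d\<in>Delta. AE x in M. nu (x \<oplus>\<^sub>2 d) = nu x) \<and>
    (\<forall>k i j. (\<lambda>x. if enat j < nu x then c k x (hbasis j) i else 0) \<in> borel_measurable borel) \<and>
    (\<forall>k. AE x in M. hunitary (nu x) (c k x)) \<and>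
    (\<forall>k. AE x in M. hadjoint (nu x) (c k x) (c k (x \<oplus>\<^sub>2 delta k))) \<and>
    (\<forall>k l. AE x in M. \<forall>v\<in>hilb (nu x).
       c k x (c l (x \<oplus>\<^sub>2 delta k) v) = c l x (c k (x \<oplus>\<^sub>2 delta l) v))"

definition discrete_measure :: "bseq measure \<Rightarrow> bool"
  where "discrete_measure M \<longleftrightarrow> (\<exists>A. countable A \<and> (AE x in M. x \<in> A))"


section \<open>The direct integral and its operators\<close>

text \<open>Vectors of the direct integral are represented by square-integrable measurable sections, and
  equality of vectors is equality almost everywhere, \<open>sec_eq\<close>. Measurability refers to the completed
  measure, so that \<open>sec_space\<close> contains every section that is almost everywhere equal to one of its
  elements, and is mapped into itself by the operators \<open>gw_J\<close> and \<open>gw_J'\<close> below, whose values on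
  a null set are arbitrary.\<close>

type_synonym vsec = "bseq \<Rightarrow> cseq"

definition sec_space :: "bseq measure \<Rightarrow> (bseq \<Rightarrow> enat) \<Rightarrow> vsec set"
  where "sec_space M nu = {f.
    (\<forall>i. (\<lambda>x. f x i) \<in> borel_measurable (completion M)) \<and>
    (AE x in M. f x \<in> hilb (nu x)) \<and>
    integrable (completion M) (\<lambda>x. \<Sum>i. (cmod (f x i))\<^sup>2)}"

definition sec_eq :: "bseq measure \<Rightarrow> vsec \<Rightarrow> vsec \<Rightarrow> bool"
  where "sec_eq M f g \<longleftrightarrow> (AE x in M. f x = g x)"

definition sec_zero :: vsec
  where "sec_zero = (\<lambda>x i. 0)"

definition sec_lin :: "complex \<Rightarrow> vsec \<Rightarrow> complex \<Rightarrow> vsec \<Rightarrow> vsec"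
  where "sec_lin a f b g = (\<lambda>x i. a * f x i + b * g x i)"

definition sec_norm :: "bseq measure \<Rightarrow> vsec \<Rightarrow> real"
  where "sec_norm M f = sqrt (\<integral>x. (\<Sum>i. (cmod (f x i))\<^sup>2) \<partial>completion M)"

definition gw_shift ::
    "bseq measure \<Rightarrow> (nat \<Rightarrow> bseq \<Rightarrow> cseq \<Rightarrow> cseq) \<Rightarrow> nat \<Rightarrow> vsec \<Rightarrow> vsec"
  where "gw_shift M c k f = (\<lambda>x i.
    complex_of_real (sqrt (enn2real (RN_deriv M (translate (delta k) M) x)))
      * c k x (f (x \<oplus>\<^sub>2 delta k)) i)"

definition gw_J ::
    "bseq measure \<Rightarrow> (nat \<Rightarrow> bseq \<Rightarrow> cseq \<Rightarrow> cseq) \<Rightarrow> nat \<Rightarrow> vsec \<Rightarrow> vsec"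
  where "gw_J M c k f = (\<lambda>x i. - \<i> * (- 1) ^ card {j. j < k \<and> x j} * gw_shift M c k f x i)"

definition gw_J' ::
    "bseq measure \<Rightarrow> (nat \<Rightarrow> bseq \<Rightarrow> cseq \<Rightarrow> cseq) \<Rightarrow> nat \<Rightarrow> vsec \<Rightarrow> vsec"
  where "gw_J' M c k f = (\<lambda>x i. (- 1) ^ card {j. j \<le> k \<and> x j} * gw_shift M c k f x i)"


section \<open>Irreducibility and invariant structures\<close>

text \<open>Closedness makes a subspace stable under \<open>sec_eq\<close>, since sections at distance 0 are limits of
  constant sequences.\<close>

definition closed_subspace :: "bseq measure \<Rightarrow> (bseq \<Rightarrow> enat) \<Rightarrow> vsec set \<Rightarrow> bool"
  where "closed_subspace M nu S \<longleftrightarrow>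
    S \<subseteq> sec_space M nu \<and> sec_zero \<in> S \<and>
    (\<forall>f\<in>S. \<forall>g\<in>S. \<forall>a b. sec_lin a f b g \<in> S) \<and>
    (\<forall>F. \<forall>g\<in>sec_space M nu.
       (\<forall>n. F n \<in> S) \<and> (\<lambda>n::nat. sec_norm M (sec_lin 1 (F n) (- 1) g)) \<longlonglongrightarrow> 0 \<longrightarrow> g \<in> S)"

definition gw_irreducible ::
    "bseq measure \<Rightarrow> (bseq \<Rightarrow> enat) \<Rightarrow> (nat \<Rightarrow> bseq \<Rightarrow> cseq \<Rightarrow> cseq) \<Rightarrow> bool"
  where "gw_irreducible M nu c \<longleftrightarrow>
    (\<exists>f\<in>sec_space M nu. \<not> sec_eq M f sec_zero) \<and>
    (\<forall>S. closed_subspace M nu S \<and> (\<forall>k. \<forall>f\<in>S. gw_J M c k f \<in> S \<and> gw_J' M c k f \<in> S) \<longrightarrow>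
       S = {f \<in> sec_space M nu. sec_eq M f sec_zero} \<or> S = sec_space M nu)"

definition invariant_antilinear ::
    "bseq measure \<Rightarrow> (bseq \<Rightarrow> enat) \<Rightarrow> (nat \<Rightarrow> bseq \<Rightarrow> cseq \<Rightarrow> cseq) \<Rightarrow> (vsec \<Rightarrow> vsec) \<Rightarrow> bool"
  where "invariant_antilinear M nu c T \<longleftrightarrow>
    (\<forall>f\<in>sec_space M nu. T f \<in> sec_space M nu) \<and>
    (\<forall>f\<in>sec_space M nu. \<forall>g\<in>sec_space M nu. sec_eq M f g \<longrightarrow> sec_eq M (T f) (T g)) \<and>
    (\<forall>f\<in>sec_space M nu. \<forall>g\<in>sec_space M nu. \<forall>a b.
       sec_eq M (T (sec_lin a f b g)) (sec_lin (cnj a) (T f) (cnj b) (T g))) \<and>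
    (\<forall>f\<in>sec_space M nu. sec_norm M (T f) = sec_norm M f) \<and>
    (\<forall>k. \<forall>f\<in>sec_space M nu.
       sec_eq M (T (gw_J M c k f)) (gw_J M c k (T f)) \<and>
       sec_eq M (T (gw_J' M c k f)) (gw_J' M c k (T f)))"

definition invariant_real_structure ::
    "bseq measure \<Rightarrow> (bseq \<Rightarrow> enat) \<Rightarrow> (nat \<Rightarrow> bseq \<Rightarrow> cseq \<Rightarrow> cseq) \<Rightarrow> (vsec \<Rightarrow> vsec) \<Rightarrow> bool"
  where "invariant_real_structure M nu c T \<longleftrightarrow>
    invariant_antilinear M nu c T \<and>
    (\<forall>f\<in>sec_space M nu. sec_eq M (T (T f)) f)"

definition invariant_quaternionic_structure ::
    "bseq measure \<Rightarrow> (bseq \<Rightarrow> enat) \<Rightarrow> (nat \<Rightarrow> bseq \<Rightarrow> cseq \<Rightarrow> cseq) \<Rightarrow> (vsec \<Rightarrow> vsec) \<Rightarrow> bool"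
  where "invariant_quaternionic_structure M nu c T \<longleftrightarrow>
    invariant_antilinear M nu c T \<and>
    (\<forall>f\<in>sec_space M nu. sec_eq M (T (T f)) (\<lambda>x i. - f x i))"

definition complex_type ::
    "bseq measure \<Rightarrow> (bseq \<Rightarrow> enat) \<Rightarrow> (nat \<Rightarrow> bseq \<Rightarrow> cseq \<Rightarrow> cseq) \<Rightarrow> bool"
  where "complex_type M nu c \<longleftrightarrow>
    (\<nexists>T. invariant_real_structure M nu c T) \<and> (\<nexists>T. invariant_quaternionic_structure M nu c T)"

text \<open>Counting measure on \<open>Delta\<close>, carried over to the Borel \<open>\<sigma>\<close>-algebra of the whole group.\<close>

definition mu_Delta :: "bseq measure"
  where "mu_Delta = distr (count_space Delta) borel (\<lambda>x. x)"

end

theory Submission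
  imports Defs
begin

text \<open>On a discrete triple the operator \<open>J\<^sub>k J'\<^sub>k\<close> is multiplication by \<open>\<i> (-1)\<^bsup>x\<^sub>k\<^esup>\<close>. An antilinear
  operator \<open>T\<close> commuting with all \<open>J\<^sub>k, J'\<^sub>k\<close> therefore anticommutes with every \<open>(-1)\<^bsup>x\<^sub>k\<^esup>\<close>, so it
  moves sections carried by a point \<open>a\<close> to sections carried by the point with all digits of \<open>a\<close>
  flipped. This point lies outside the orbit \<open>a + \<Delta>\<close>, whereas irreducibility forces \<open>\<mu>\<close> to be
  carried by a single orbit; so \<open>T\<close> cannot preserve norms. In particular there is no invariant real
  structure either.\<close>

section \<open>Translations of binary sequences\<close>

lemma bplus_cancel [simp]: "x \<oplus>\<^sub>2 d \<oplus>\<^sub>2 d = x"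
  by (auto simp: bplus_def)

lemma delta_in_Delta [simp]: "delta k \<in> Delta"
  by (simp add: Delta_def delta_def)

lemma bplus_in_Delta: "x \<in> Delta \<Longrightarrow> y \<in> Delta \<Longrightarrow> x \<oplus>\<^sub>2 y \<in> Delta"
  unfolding Delta_def bplus_def
  by (auto intro: finite_subset[of _ "{n. x n} \<union> {n. y n}"])

lemma bplus_in_Delta_iff [simp]: "d \<in> Delta \<Longrightarrow> x \<oplus>\<^sub>2 d \<in> Delta \<longleftrightarrow> x \<in> Delta"
  using bplus_in_Delta[of x d] bplus_in_Delta[of "x \<oplus>\<^sub>2 d" d] by auto

lemma countable_Delta: "countable Delta"
proof -
  have "Delta = (\<lambda>F n. n \<in> F) ` {F. finite F}"
    by (auto simp: Delta_def image_def intro!: exI[of _ "{n. _ n}"])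
  then show ?thesis
    using countable_image[OF countable_Collect_finite] by metis
qed

text \<open>Translation is continuous: each coordinate of the sum is a coordinate projection, either
  kept or negated.\<close>

lemma measurable_bplus [measurable]: "(\<lambda>x. x \<oplus>\<^sub>2 d) \<in> borel \<rightarrow>\<^sub>M borel"
proof (intro borel_measurable_continuous_onI continuous_on_coordinatewise_then_product)
  fix n
  have "continuous_on UNIV (\<lambda>b::bool. b \<noteq> d n)"
    by (cases "d n") (auto simp: continuous_on_def tendsto_def eventually_at_topological open_bool_def
      intro: exI[of _ "{_}"])
  then have "continuous_on UNIV ((\<lambda>b. b \<noteq> d n) \<circ> (\<lambda>x::bseq. x n))"
    by (intro continuous_on_compose continuous_on_product_coordinates) (auto intro: continuous_on_subset)
  then show "continuous_on UNIV (\<lambda>x. (x \<oplus>\<^sub>2 d) n)"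
    by (simp add: bplus_def o_def)
qed

text \<open>A point is the intersection of the closed cylinders that fix one digit each.
  Consequently every countable set is Borel.\<close>

lemma singleton_borel [simp]: "{x::bseq} \<in> sets borel"
proof -
  have "closed ((\<lambda>y::bseq. y n) -` {x n})" for n
    by (intro closed_vimage closed_singleton continuous_on_product_coordinates)
  then have "closed (\<Inter>n. (\<lambda>y::bseq. y n) -` {x n})"
    by auto
  also have "(\<Inter>n. (\<lambda>y::bseq. y n) -` {x n}) = {x}"
    by auto
  finally show ?thesis
    by (rule borel_closed)
qed

lemma emeasure_translate_singleton:
  assumes "sets M = sets borel"
  shows "emeasure (translate d M) {x} = emeasure M {x \<oplus>\<^sub>2 d}"
proof -
  have "(\<lambda>x. x \<oplus>\<^sub>2 d) -` {x} = {x \<oplus>\<^sub>2 d}"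
    by auto
  moreover have "(\<lambda>x. x \<oplus>\<^sub>2 d) \<in> M \<rightarrow>\<^sub>M borel" "space M = UNIV"
    using assms sets_eq_imp_space_eq[OF assms] by (simp_all add: measurable_cong_sets[OF assms refl])
  ultimately show ?thesis
    unfolding translate_def by (subst emeasure_distr) auto
qed

section \<open>Model Hilbert spaces\<close>

lemma hilb_zero: "(\<lambda>i. 0) \<in> hilb n"
  by (simp add: hilb_def)

text \<open>The triangle inequality and (s + t)^2 \<le> 2 s^2 + 2 t^2. Having no cross term, the
  bound can be summed over coordinates and integrated over sections.\<close>

lemma cmod_lin_sq_le:
  "(cmod (a * v + b * w))\<^sup>2 \<le> 2 * (cmod a)\<^sup>2 * (cmod v)\<^sup>2 + 2 * (cmod b)\<^sup>2 * (cmod w)\<^sup>2"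
proof -
  have "(cmod (a * v + b * w))\<^sup>2 \<le> (cmod a * cmod v + cmod b * cmod w)\<^sup>2"
    by (intro power_mono) (auto simp flip: norm_mult intro: norm_triangle_ineq)
  also have "\<dots> \<le> 2 * (cmod a * cmod v)\<^sup>2 + 2 * (cmod b * cmod w)\<^sup>2"
    using sum_squares_bound[of "cmod a * cmod v" "cmod b * cmod w"] by (simp add: power2_sum)
  finally show ?thesis
    by (simp add: power_mult_distrib mult.assoc)
qed

lemma
  assumes "v \<in> hilb n" "w \<in> hilb n"
  shows hilb_lin: "(\<lambda>i. a * v i + b * w i) \<in> hilb n"
    and hilb_lin_norm_le: "(\<Sum>i. (cmod (a * v i + b * w i))\<^sup>2)
      \<le> 2 * (cmod a)\<^sup>2 * (\<Sum>i. (cmod (v i))\<^sup>2) + 2 * (cmod b)\<^sup>2 * (\<Sum>i. (cmod (w i))\<^sup>2)"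
proof -
  have v: "summable (\<lambda>i. (cmod (v i))\<^sup>2)" and w: "summable (\<lambda>i. (cmod (w i))\<^sup>2)"
    using assms by (auto simp: hilb_def)
  have s: "summable (\<lambda>i. 2 * (cmod a)\<^sup>2 * (cmod (v i))\<^sup>2 + 2 * (cmod b)\<^sup>2 * (cmod (w i))\<^sup>2)"
    by (intro summable_add summable_mult v w)
  have s': "summable (\<lambda>i. (cmod (a * v i + b * w i))\<^sup>2)"
    by (rule summable_comparison_test'[OF s]) (use cmod_lin_sq_le in auto)
  then show "(\<lambda>i. a * v i + b * w i) \<in> hilb n"
    using assms by (auto simp: hilb_def)
  show "(\<Sum>i. (cmod (a * v i + b * w i))\<^sup>2)
      \<le> 2 * (cmod a)\<^sup>2 * (\<Sum>i. (cmod (v i))\<^sup>2) + 2 * (cmod b)\<^sup>2 * (\<Sum>i. (cmod (w i))\<^sup>2)"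
    using suminf_le[OF cmod_lin_sq_le s' s] v w
    by (simp add: suminf_add[symmetric] suminf_mult summable_mult)
qed

lemma hilb_scale: "v \<in> hilb n \<Longrightarrow> (\<lambda>i. a * v i) \<in> hilb n"
  using hilb_lin[of v n v a 0] by simp

lemma hinner_self: "v \<in> hilb n \<Longrightarrow> hinner v v = of_real (\<Sum>i. (cmod (v i))\<^sup>2)"
  by (simp add: hinner_def hilb_def suminf_of_real complex_norm_square[symmetric] flip: of_real_power)

lemma hinner_hbasis: "hinner (hbasis j) w = cnj (w j)"
proof -
  have "(\<lambda>i. hbasis j i * cnj (w i)) sums (\<Sum>i\<in>{j}. hbasis j i * cnj (w i))"
    by (rule sums_finite) (auto simp: hbasis_def)
  then show ?thesis
    by (simp add: hinner_def sums_iff hbasis_def)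
qed

lemma hbasis_hilb: "enat j < n \<Longrightarrow> hbasis j \<in> hilb n"
  by (auto simp: hilb_def hbasis_def intro!: summable_finite[of "{j}"] split: if_splits)

lemma hbasis_0_hilb: "n \<noteq> 0 \<Longrightarrow> hbasis 0 \<in> hilb n"
  by (intro hbasis_hilb) (simp add: zero_enat_def[symmetric] zero_less_iff_neq_zero)

text \<open>Testing against \<open>hbasis j\<close> reads off coordinate \<open>j\<close> below
  \<open>n\<close>; from \<open>n\<close> on both vectors vanish.\<close>

lemma hilb_eqI:
  assumes "v \<in> hilb n" "w \<in> hilb n" "\<And>u. u \<in> hilb n \<Longrightarrow> hinner u v = hinner u w"
  shows "v = w"
proof
  fix j
  show "v j = w j"
  proof (cases "enat j < n")
    case True
    then show ?thesis
      using assms(3)[OF hbasis_hilb[OF True]] by (simp add: hinner_hbasis)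
  next
    case False
    then show ?thesis
      using assms by (simp add: hilb_def)
  qed
qed

lemma hunitary_mem: "hunitary n U \<Longrightarrow> v \<in> hilb n \<Longrightarrow> U v \<in> hilb n"
  unfolding hunitary_def by blast

lemma hunitary_scale:
  assumes "hunitary n U" "v \<in> hilb n"
  shows "U (\<lambda>i. a * v i) = (\<lambda>i. a * U v i)"
proof -
  have "U (\<lambda>i. a * v i + 0 * v i) = (\<lambda>i. a * U v i + 0 * U v i)"
    using assms unfolding hunitary_def by blast
  then show ?thesis by simp
qed

lemma hunitary_norm:
  assumes "hunitary n U" "v \<in> hilb n"
  shows "(\<Sum>i. (cmod (U v i))\<^sup>2) = (\<Sum>i. (cmod (v i))\<^sup>2)"
proof -
  have "hinner (U v) (U v) = hinner v v"
    using assms unfolding hunitary_def by blast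
  then show ?thesis
    using assms hunitary_mem[OF assms] by (simp add: hinner_self)
qed

text \<open>Surjectivity gives \<open>w = U u\<close>. Pairing \<open>U' w\<close> with
  \<open>v\<close> yields the product of \<open>U v\<close> and \<open>U u\<close>, hence that of
  \<open>v\<close> and \<open>u\<close>, so \<open>U' w = u\<close>.\<close>

lemma hunitary_hadjoint_cancel:
  assumes U: "hunitary n U" and U': "hunitary n U'" and adj: "hadjoint n U U'" and w: "w \<in> hilb n"
  shows "U (U' w) = w"
proof -
  from U w obtain u where u: "u \<in> hilb n" "w = U u"
    unfolding hunitary_def by blast
  have "U' w = u"
  proof (rule hilb_eqI)
    fix v assume "v \<in> hilb n"
    then show "hinner v (U' w) = hinner v u"
      using adj U u w unfolding hadjoint_def hunitary_def by metis
  qed (use u U' w hunitary_mem in auto)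
  then show ?thesis
    using u by simp
qed

section \<open>Discrete measures\<close>

text \<open>For a discrete measure this set carries all the mass, so statements almost everywhere
  become statements at every atom.\<close>

definition atoms :: "bseq measure \<Rightarrow> bseq set"
  where "atoms M = {x. emeasure M {x} \<noteq> 0}"

locale discrete_gw =
  fixes M :: "bseq measure" and nu :: "bseq \<Rightarrow> enat" and c :: "nat \<Rightarrow> bseq \<Rightarrow> cseq \<Rightarrow> cseq"
  assumes triple: "gw_triple M nu c" and discrete: "discrete_measure M"
begin

lemma sets_M: "sets M = sets borel"
  using triple by (simp add: gw_triple_def)

lemma space_M: "space M = UNIV"
  using sets_eq_imp_space_eq[OF sets_M] by simp

sublocale sigma_finite_measure M
  using triple by (simp add: gw_triple_def)

lemma AE_imp_atom:
  assumes "AE x in M. P x" "x \<in> atoms M"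
  shows "P x"
proof (rule ccontr)
  assume "\<not> P x"
  from assms(1) obtain N where N: "{y \<in> space M. \<not> P y} \<subseteq> N" "N \<in> null_sets M"
    by (auto simp: eventually_ae_filter)
  then have "{x} \<subseteq> N"
    using \<open>\<not> P x\<close> by (auto simp: space_M)
  then have "emeasure M {x} = 0"
    using N by (metis emeasure_mono le_zero_eq null_setsD1 null_setsD2)
  with assms(2) show False
    by (simp add: atoms_def)
qed

lemma countable_atoms: "countable (atoms M)"
  using discrete AE_imp_atom unfolding discrete_measure_def
  by (metis (mono_tags, lifting) countable_subset subsetI)

lemma atoms_borel: "atoms M \<in> sets borel"
  using countable_atoms by (rule sets.countable[rotated]) simp

text \<open>The points of a countable carrier that are not atoms form a countable union of null
  singletons.\<close>

lemma AE_in_atoms: "AE x in M. x \<in> atoms M"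
proof -
  obtain A where A: "countable A" "AE x in M. x \<in> A"
    using discrete by (auto simp: discrete_measure_def)
  have "(\<Union>x\<in>A - atoms M. {x}) \<in> null_sets M"
    using A by (intro null_sets_UN') (auto simp: atoms_def null_sets_def sets_M)
  then have "AE x in M. x \<notin> (\<Union>x\<in>A - atoms M. {x})"
    by (rule AE_not_in)
  then show ?thesis
    using A(2) by eventually_elim auto
qed

lemma AE_iff_atoms: "(AE x in M. P x) \<longleftrightarrow> (\<forall>x\<in>atoms M. P x)"
  using AE_imp_atom AE_in_atoms by (auto elim!: eventually_mono)

lemma sec_eq_iff: "sec_eq M f g \<longleftrightarrow> (\<forall>x\<in>atoms M. f x = g x)"
  by (simp add: sec_eq_def AE_iff_atoms)

text \<open>Any set splits into a countable, hence Borel, set of atoms and a subset of a null set.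
  Measurability for the completion is therefore automatic.\<close>

lemma sets_completion_M: "sets (completion M) = UNIV"
proof -
  have "S \<in> sets (completion M)" for S
  proof (rule sets_completionI)
    show "S = (S \<inter> atoms M) \<union> (S - atoms M)" by auto
    have "countable (S \<inter> atoms M)"
      using countable_atoms by (rule countable_subset[rotated]) auto
    then have "S \<inter> atoms M \<in> sets borel"
      by (rule sets.countable[rotated]) simp
    then show "S \<inter> atoms M \<in> sets M"
      by (simp add: sets_M)
    have "- atoms M \<in> sets M"
      using atoms_borel borel_comp by (simp add: sets_M)
    then show "- atoms M \<in> null_sets M"
      using AE_in_atoms by (simp add: AE_iff_null_sets)
  qed auto
  then show ?thesis by auto
qed

lemma borel_measurable_completion_M: "f \<in> borel_measurable (completion M)"
  by (simp add: measurable_def sets_completion_M)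

text \<open>By \<sigma>-finiteness the point lies in some set of finite measure. Finite masses
  permit cancellation in the extended reals later on.\<close>

lemma emeasure_singleton_finite: "emeasure M {x} < \<infinity>"
proof -
  obtain A :: "nat \<Rightarrow> bseq set" where A: "range A \<subseteq> sets M" "(\<Union>i. A i) = space M"
      "\<And>i. emeasure M (A i) \<noteq> \<infinity>"
    using sigma_finite by blast
  have "x \<in> (\<Union>i. A i)"
    using A(2) by (simp add: space_M)
  then obtain i where "x \<in> A i"
    by blast
  then have "emeasure M {x} \<le> emeasure M (A i)"
    using A by (intro emeasure_mono) auto
  then show ?thesis
    using A(3)[of i] by (simp add: less_top order_le_less_trans)
qed

text \<open>Discarding the values off the atoms makes any function Borel measurable, which is what
  transfers integrals between \<^term>\<open>M\<close> and its completion.\<close>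

lemma restrict_atoms_measurable:
  fixes g :: "bseq \<Rightarrow> ennreal"
  shows "(\<lambda>x. if x \<in> atoms M then g x else 0) \<in> borel_measurable borel"
proof (rule measurableI)
  fix B :: "ennreal set"
  have eq: "(\<lambda>x. if x \<in> atoms M then g x else 0) -` B \<inter> space borel =
      {x \<in> atoms M. g x \<in> B} \<union> (if 0 \<in> B then - atoms M else {})"
    by (auto split: if_splits)
  have "countable {x \<in> atoms M. g x \<in> B}"
    using countable_atoms by (rule countable_subset[rotated]) auto
  then have 1: "{x \<in> atoms M. g x \<in> B} \<in> sets borel"
    by (rule sets.countable[rotated]) simp
  have 2: "- atoms M \<in> sets borel"
    using atoms_borel by (rule borel_comp)
  show "(\<lambda>x. if x \<in> atoms M then g x else 0) -` B \<inter> space borel \<in> sets borel"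
    unfolding eq using 1 2 by (intro sets.Un) simp_all
qed simp

lemma nn_integral_completion_M:
  "(\<integral>\<^sup>+x. g x \<partial>completion M) = (\<integral>\<^sup>+x. (if x \<in> atoms M then g x else 0) \<partial>M)"
proof -
  have "(\<integral>\<^sup>+x. g x \<partial>completion M) = (\<integral>\<^sup>+x. (if x \<in> atoms M then g x else 0) \<partial>completion M)"
    by (rule nn_integral_cong_AE, rule eventually_mono[OF AE_completion[OF AE_in_atoms]]) simp
  also have "\<dots> = (\<integral>\<^sup>+x. (if x \<in> atoms M then g x else 0) \<partial>M)"
    by (rule nn_integral_completion)
  finally show ?thesis .
qed

section \<open>The operators at the atoms\<close>

lemma translate_density: "density M (RN_deriv M (translate (delta k) M)) = translate (delta k) M"
proof (rule density_RN_deriv)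
  show "absolutely_continuous M (translate (delta k) M)"
    using triple delta_in_Delta unfolding gw_triple_def quasi_invariant_def by blast
qed (simp add: translate_def sets_M)

text \<open>Quasi-invariance in both directions gives the measure and its translate the same null
  sets; this is compared on a singleton.\<close>

lemma atoms_shift [simp]: "x \<oplus>\<^sub>2 delta k \<in> atoms M \<longleftrightarrow> x \<in> atoms M"
proof -
  have q: "null_sets M = null_sets (translate (delta k) M)"
    using triple delta_in_Delta
    unfolding gw_triple_def quasi_invariant_def absolutely_continuous_def by blast
  have "emeasure M {x} = 0 \<longleftrightarrow> {x} \<in> null_sets M"
    by (auto simp: null_sets_def sets_M)
  also have "\<dots> \<longleftrightarrow> emeasure (translate (delta k) M) {x} = 0"
    unfolding q by (auto simp: null_sets_def translate_def)
  finally show ?thesis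
    by (simp add: atoms_def emeasure_translate_singleton[OF sets_M])
qed

lemma nu_nonzero: "nu x \<noteq> 0"
  using triple by (simp add: gw_triple_def)

lemma nu_shift: "x \<in> atoms M \<Longrightarrow> nu (x \<oplus>\<^sub>2 delta k) = nu x"
  using triple delta_in_Delta unfolding gw_triple_def AE_iff_atoms by blast

lemma c_unitary: "x \<in> atoms M \<Longrightarrow> hunitary (nu x) (c k x)"
  using triple unfolding gw_triple_def AE_iff_atoms by blast

lemma c_adjoint: "x \<in> atoms M \<Longrightarrow> hadjoint (nu x) (c k x) (c k (x \<oplus>\<^sub>2 delta k))"
  using triple unfolding gw_triple_def AE_iff_atoms by blast

text \<open>The operators at \<open>x\<close> and at its translate are unitary on a common fibre and
  adjoint to each other, hence mutually inverse.\<close>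

lemma c_cancel:
  assumes "x \<in> atoms M" "v \<in> hilb (nu x)"
  shows "c k x (c k (x \<oplus>\<^sub>2 delta k) v) = v"
  using assms c_unitary[of "x \<oplus>\<^sub>2 delta k" k]
  by (intro hunitary_hadjoint_cancel[OF c_unitary _ c_adjoint]) (auto simp: nu_shift)

section \<open>Radon-Nikodym derivatives and signs at the atoms\<close>

abbreviation rn :: "nat \<Rightarrow> bseq \<Rightarrow> ennreal"
  where "rn k \<equiv> RN_deriv M (translate (delta k) M)"

text \<open>The density identity evaluated on a singleton: at an atom the derivative is the ratio of
  the masses of the translated point and the point.\<close>

lemma rn_atom: "rn k x * emeasure M {x} = emeasure M {x \<oplus>\<^sub>2 delta k}"
proof -
  have "emeasure M {x \<oplus>\<^sub>2 delta k} = emeasure (density M (rn k)) {x}"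
    by (simp add: translate_density emeasure_translate_singleton[OF sets_M])
  also have "\<dots> = (\<integral>\<^sup>+y. rn k y * indicator {x} y \<partial>M)"
    by (rule emeasure_density) (auto simp: sets_M)
  also have "\<dots> = rn k x * emeasure M {x}"
    by (rule nn_integral_indicator_singleton) (auto simp: sets_M)
  finally show ?thesis by simp
qed

lemma rn_finite:
  assumes "x \<in> atoms M"
  shows "rn k x < \<infinity>"
  using rn_atom[of k x] emeasure_singleton_finite[of "x \<oplus>\<^sub>2 delta k"] assms
  by (auto simp: atoms_def ennreal_mult_less_top less_top[symmetric] ennreal_top_mult)

text \<open>The two mass ratios are reciprocal, because translating twice returns to
  \<open>x\<close>.\<close>

lemma rn_mult_shift:
  assumes "x \<in> atoms M"
  shows "enn2real (rn k x) * enn2real (rn k (x \<oplus>\<^sub>2 delta k)) = 1"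
proof -
  \<comment> \<open>The mass of \<open>x\<close> is kept as a common factor; it may be cancelled
    since it is neither zero nor infinite.\<close>
  have "emeasure M {x} * (rn k x * rn k (x \<oplus>\<^sub>2 delta k)) = emeasure M {x} * 1"
    using rn_atom[of k x] rn_atom[of k "x \<oplus>\<^sub>2 delta k"]
    by (simp add: mult.commute flip: mult.assoc)
  then have "rn k x * rn k (x \<oplus>\<^sub>2 delta k) = 1"
    using assms emeasure_singleton_finite[of x]
    unfolding ennreal_mult_cancel_left by (simp add: atoms_def less_top[symmetric])
  then show ?thesis
    by (simp flip: enn2real_mult)
qed

text \<open>Digits below \<open>k\<close> are unaffected by the translation, so their signs square
  to 1. Only the flipped digit at \<open>k\<close> is left, and it is 1 exactly when
  \<open>x k\<close> is 0.\<close>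

lemma sign_shift:
  "(-1) ^ card {j. j < k \<and> x j} * (-1) ^ card {j. j \<le> k \<and> (x \<oplus>\<^sub>2 delta k) j}
     = (if x k then 1 else (-1::complex))"
proof -
  have "{j. j \<le> k \<and> (x \<oplus>\<^sub>2 delta k) j} = {j. j < k \<and> x j} \<union> (if x k then {} else {k})"
    by (auto simp: bplus_def delta_def le_less)
  then have "card {j. j \<le> k \<and> (x \<oplus>\<^sub>2 delta k) j} = card {j. j < k \<and> x j} + (if x k then 0 else 1)"
    by simp
  then show ?thesis
    by (simp flip: power_mult_distrib)
qed

text \<open>The two translations cancel, and so do the unitaries and the density factors. A diagonal
  operator remains whose value depends on the digit \<open>x k\<close> alone.\<close>

lemma gw_J_gw_J':
  assumes x: "x \<in> atoms M" and f: "f x \<in> hilb (nu x)"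
  shows "gw_J M c k (gw_J' M c k f) x = (\<lambda>i. (if x k then - \<i> else \<i>) * f x i)"
proof
  fix i
  let ?y = "x \<oplus>\<^sub>2 delta k"
  define r where "r = complex_of_real (sqrt (enn2real (rn k x)))"
  define r' where "r' = complex_of_real (sqrt (enn2real (rn k ?y)))"
  define s where "s = ((-1) ^ card {j. j \<le> k \<and> ?y j} :: complex)"
  define s0 where "s0 = ((-1) ^ card {j. j < k \<and> x j} :: complex)"
  have rr: "r * r' = 1"
    using rn_mult_shift[OF x, of k]
    by (simp add: r_def r'_def flip: of_real_mult real_sqrt_mult)
  have ss: "s0 * s = (if x k then 1 else -1)"
    using sign_shift by (simp add: s_def s0_def)
  have cf: "c k ?y (f x) \<in> hilb (nu x)"
    using hunitary_mem[OF c_unitary[of ?y k]] x f by (simp add: nu_shift)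
  have "gw_J' M c k f ?y = (\<lambda>i. (s * r') * c k ?y (f x) i)"
    by (simp add: gw_J'_def gw_shift_def s_def r'_def mult_ac)
  then have "c k x (gw_J' M c k f ?y) i = s * r' * f x i"
    using hunitary_scale[OF c_unitary[OF x] cf, of k "s * r'"] c_cancel[OF x f] by simp
  then have "gw_J M c k (gw_J' M c k f) x i = - \<i> * s0 * (r * (s * r' * f x i))"
    by (simp add: gw_J_def gw_shift_def r_def s0_def)
  also have "\<dots> = - \<i> * (s0 * s) * (r * r') * f x i"
    by (simp add: mult_ac)
  finally show "gw_J M c k (gw_J' M c k f) x i = (if x k then - \<i> else \<i>) * f x i"
    by (simp add: rr ss)
qed

section \<open>Square-integrable sections\<close>

text \<open>Measurability being automatic, only the fibre condition at atoms and finiteness of an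
  integral against \<open>M\<close> itself survive.\<close>

lemma sec_space_iff:
  "f \<in> sec_space M nu \<longleftrightarrow> (\<forall>x\<in>atoms M. f x \<in> hilb (nu x)) \<and>
    (\<integral>\<^sup>+x. (if x \<in> atoms M then ennreal (\<Sum>i. (cmod (f x i))\<^sup>2) else 0) \<partial>M) < \<infinity>"
proof -
  have *: "(if x \<in> atoms M then ennreal (norm (\<Sum>i. (cmod (f x i))\<^sup>2)) else 0) =
      (if x \<in> atoms M then ennreal (\<Sum>i. (cmod (f x i))\<^sup>2) else 0)"
    if "\<forall>x\<in>atoms M. f x \<in> hilb (nu x)" for x
    using that by (auto simp: hilb_def suminf_nonneg)
  show ?thesis
    unfolding sec_space_def mem_Collect_eq AE_iff_atoms integrable_iff_bounded nn_integral_completion_M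
    by (auto simp: * borel_measurable_completion_M cong: conj_cong)
qed

lemma sec_spaceD: "f \<in> sec_space M nu \<Longrightarrow> x \<in> atoms M \<Longrightarrow> f x \<in> hilb (nu x)"
  by (simp add: sec_space_iff)

lemma sec_space_zero: "sec_zero \<in> sec_space M nu"
  by (simp add: sec_space_iff sec_zero_def hilb_zero cong: if_cong)

lemma sec_space_lin:
  assumes "f \<in> sec_space M nu" "g \<in> sec_space M nu"
  shows "sec_lin a f b g \<in> sec_space M nu"
proof -
  define F where "F = (\<lambda>x. if x \<in> atoms M then ennreal (\<Sum>i. (cmod (f x i))\<^sup>2) else 0)"
  define G where "G = (\<lambda>x. if x \<in> atoms M then ennreal (\<Sum>i. (cmod (g x i))\<^sup>2) else 0)"
  define A where "A = ennreal (2 * (cmod a)\<^sup>2)"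
  define B where "B = ennreal (2 * (cmod b)\<^sup>2)"
  have [measurable]: "F \<in> borel_measurable M" "G \<in> borel_measurable M"
    unfolding F_def G_def measurable_cong_sets[OF sets_M refl] by (rule restrict_atoms_measurable)+
  have "(\<integral>\<^sup>+x. (if x \<in> atoms M then ennreal (\<Sum>i. (cmod (a * f x i + b * g x i))\<^sup>2) else 0) \<partial>M)
      \<le> (\<integral>\<^sup>+x. A * F x + B * G x \<partial>M)"
  proof (rule nn_integral_mono)
    fix x
    have "(\<Sum>i. (cmod (a * f x i + b * g x i))\<^sup>2)
      \<le> 2 * (cmod a)\<^sup>2 * (\<Sum>i. (cmod (f x i))\<^sup>2) + 2 * (cmod b)\<^sup>2 * (\<Sum>i. (cmod (g x i))\<^sup>2)"
      and "0 \<le> (\<Sum>i. (cmod (f x i))\<^sup>2)" "0 \<le> (\<Sum>i. (cmod (g x i))\<^sup>2)" if "x \<in> atoms M"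
      using hilb_lin_norm_le[OF assms[THEN sec_spaceD, OF that]] assms[THEN sec_spaceD, OF that]
      by (auto simp: hilb_def suminf_nonneg)
    then show "(if x \<in> atoms M then ennreal (\<Sum>i. (cmod (a * f x i + b * g x i))\<^sup>2) else 0)
        \<le> A * F x + B * G x"
      by (auto simp: A_def B_def F_def G_def ennreal_leI simp flip: ennreal_mult ennreal_plus)
  qed
  also have "\<dots> = A * (\<integral>\<^sup>+x. F x \<partial>M) + B * (\<integral>\<^sup>+x. G x \<partial>M)"
    by (simp add: nn_integral_add nn_integral_cmult)
  also have "\<dots> < \<infinity>"
    using assms by (simp add: sec_space_iff F_def G_def A_def B_def ennreal_mult_less_top)
  finally show ?thesis
    using assms[THEN sec_spaceD] by (simp add: sec_space_iff sec_lin_def hilb_lin)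
qed

text \<open>The unimodular factor \<open>s\<close> covers the phases and signs of both
  \<open>gw_J\<close> and \<open>gw_J'\<close>. Unitarity on fibres and a change of variables show
  that the square integral is preserved.\<close>

lemma gw_shift_sec_space:
  assumes f: "f \<in> sec_space M nu" and s: "\<And>x. cmod (s x) = 1"
  shows "(\<lambda>x i. s x * gw_shift M c k f x i) \<in> sec_space M nu"
proof -
  define F where "F = (\<lambda>x. if x \<in> atoms M then ennreal (\<Sum>i. (cmod (f x i))\<^sup>2) else 0)"
  have F: "F \<in> borel_measurable borel"
    unfolding F_def by (rule restrict_atoms_measurable)
  then have Fs: "(\<lambda>x. F (x \<oplus>\<^sub>2 delta k)) \<in> borel_measurable borel"
    by measurable
  have fy: "f (x \<oplus>\<^sub>2 delta k) \<in> hilb (nu x)" if "x \<in> atoms M" for x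
    using sec_spaceD[OF f, of "x \<oplus>\<^sub>2 delta k"] that by (simp add: nu_shift)
  have mem: "c k x (f (x \<oplus>\<^sub>2 delta k)) \<in> hilb (nu x)" if "x \<in> atoms M" for x
    using hunitary_mem[OF c_unitary fy] that by blast
  have norm: "ennreal (\<Sum>i. (cmod (s x * gw_shift M c k f x i))\<^sup>2) = rn k x * F (x \<oplus>\<^sub>2 delta k)"
    if x: "x \<in> atoms M" for x
  proof -
    have sm: "summable (\<lambda>i. (cmod (c k x (f (x \<oplus>\<^sub>2 delta k)) i))\<^sup>2)"
      using mem[OF x] by (simp add: hilb_def)
    have "(\<Sum>i. (cmod (s x * gw_shift M c k f x i))\<^sup>2)
        = (\<Sum>i. enn2real (rn k x) * (cmod (c k x (f (x \<oplus>\<^sub>2 delta k)) i))\<^sup>2)"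
      by (simp add: gw_shift_def norm_mult s power_mult_distrib)
    also have "\<dots> = enn2real (rn k x) * (\<Sum>i. (cmod (f (x \<oplus>\<^sub>2 delta k) i))\<^sup>2)"
      by (simp add: suminf_mult[OF sm] hunitary_norm[OF c_unitary fy] x)
    finally have "ennreal (\<Sum>i. (cmod (s x * gw_shift M c k f x i))\<^sup>2)
        = ennreal (enn2real (rn k x)) * ennreal (\<Sum>i. (cmod (f (x \<oplus>\<^sub>2 delta k) i))\<^sup>2)"
      by (simp add: ennreal_mult')
    then show ?thesis
      using rn_finite[OF x, of k] x by (simp add: F_def less_top[symmetric])
  qed
  have "(\<integral>\<^sup>+x. (if x \<in> atoms M then ennreal (\<Sum>i. (cmod (s x * gw_shift M c k f x i))\<^sup>2) else 0) \<partial>M)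
      = (\<integral>\<^sup>+x. rn k x * F (x \<oplus>\<^sub>2 delta k) \<partial>M)"
    by (rule nn_integral_cong) (auto simp: norm F_def)
  \<comment> \<open>The derivative is the density of the translated measure, and the translation
    inside \<open>F\<close> undoes that translation.\<close>
  also have "\<dots> = (\<integral>\<^sup>+x. F (x \<oplus>\<^sub>2 delta k) \<partial>density M (rn k))"
    using Fs by (intro nn_integral_density[symmetric] borel_measurable_RN_deriv)
      (simp add: measurable_cong_sets[OF sets_M refl])
  also have "\<dots> = (\<integral>\<^sup>+x. F x \<partial>M)"
    unfolding translate_density unfolding translate_def
    using Fs measurable_bplus by (subst nn_integral_distr) (auto simp: measurable_cong_sets[OF sets_M refl])
  also have "\<dots> < \<infinity>"
    using f by (simp add: sec_space_iff F_def)
  finally show ?thesis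
    using mem by (simp add: sec_space_iff) (simp add: gw_shift_def hilb_scale)
qed

lemma gw_J_sec_space: "f \<in> sec_space M nu \<Longrightarrow> gw_J M c k f \<in> sec_space M nu"
  unfolding gw_J_def by (rule gw_shift_sec_space) (simp_all add: norm_mult norm_power)

lemma gw_J'_sec_space: "f \<in> sec_space M nu \<Longrightarrow> gw_J' M c k f \<in> sec_space M nu"
  unfolding gw_J'_def by (rule gw_shift_sec_space) (simp_all add: norm_power)

lemma gw_J_cong: "sec_eq M f g \<Longrightarrow> sec_eq M (gw_J M c k f) (gw_J M c k g)"
  by (simp add: sec_eq_iff gw_J_def gw_shift_def)

text \<open>Linearity of the unitaries is available on the fibre only, so 0 is sent to 0 by scaling
  the zero vector with 0.\<close>

lemma gw_shift_zero:
  assumes "x \<in> atoms M" "f (x \<oplus>\<^sub>2 delta k) = (\<lambda>i. 0)"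
  shows "gw_shift M c k f x i = 0"
  using assms hunitary_scale[OF c_unitary[OF assms(1)] hilb_zero, of k 0] by (simp add: gw_shift_def)

section \<open>Sections carried by one point, and evaluation at atoms\<close>

definition point_section :: "bseq \<Rightarrow> vsec"
  where "point_section a = (\<lambda>x i. if x = a then hbasis 0 i else 0)"

text \<open>No fibre is zero, so \<open>hbasis 0\<close> lies in each of them. The square norm is
  the mass of the point, which is finite.\<close>

lemma point_section_sec_space: "point_section a \<in> sec_space M nu"
proof -
  have mem: "point_section a x \<in> hilb (nu x)" for x
    using hbasis_0_hilb[OF nu_nonzero] by (cases "x = a") (simp_all add: point_section_def hilb_zero)
  have s: "(\<Sum>i. (cmod (hbasis 0 i))\<^sup>2) = 1"
    using hinner_self[OF hbasis_0_hilb[of 1]] hinner_hbasis[of 0 "hbasis 0"]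
    by (simp add: hbasis_def)
  have "(\<integral>\<^sup>+x. (if x \<in> atoms M then ennreal (\<Sum>i. (cmod (point_section a x i))\<^sup>2) else 0) \<partial>M)
      \<le> (\<integral>\<^sup>+x. indicator {a} x \<partial>M)"
    by (intro nn_integral_mono) (simp add: point_section_def s indicator_def)
  also have "\<dots> < \<infinity>"
    using emeasure_singleton_finite by (simp add: sets_M)
  finally show ?thesis
    using mem by (simp add: sec_space_iff)
qed

lemma point_section_nonzero: "point_section a a \<noteq> (\<lambda>i. 0)"
  by (auto simp: point_section_def hbasis_def fun_eq_iff)

text \<open>One coordinate at one point contributes at most the whole integral. Evaluation at an
  atom is thus continuous for the norm.\<close>

lemma norm_at_atom_le:
  assumes f: "f \<in> sec_space M nu" and x: "x \<in> atoms M"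
  shows "(cmod (f x i))\<^sup>2 * measure M {x} \<le> (sec_norm M f)\<^sup>2"
proof -
  let ?h = "\<lambda>x. \<Sum>i. (cmod (f x i))\<^sup>2"
  have int: "integrable (completion M) ?h"
    using f by (simp add: sec_space_def)
  have nonneg: "AE y in completion M. 0 \<le> ?h y"
    using sec_spaceD[OF f] by (intro AE_completion) (auto simp: AE_iff_atoms hilb_def suminf_nonneg)
  have sm: "summable (\<lambda>i. (cmod (f x i))\<^sup>2)"
    using sec_spaceD[OF f x] by (simp add: hilb_def)
  have "(cmod (f x i))\<^sup>2 \<le> ?h x"
    using sum_le_suminf[OF sm, of "{i}"] by simp
  then have "(cmod (f x i))\<^sup>2 * measure M {x} \<le> ?h x * measure M {x}"
    by (rule mult_right_mono) simp
  also have "\<dots> = (\<integral>y. indicator {x} y * ?h x \<partial>completion M)"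
    using emeasure_singleton_finite[of x]
    by (simp add: sets_completion_M sets_M)
  also have "\<dots> \<le> (\<integral>y. ?h y \<partial>completion M)"
  proof (rule integral_mono_AE[OF _ int])
    show "integrable (completion M) (\<lambda>y. indicator {x} y * ?h x)"
      using emeasure_singleton_finite[of x]
      by (intro integrable_mult_left integrable_real_indicator) (auto simp: sets_completion_M sets_M)
    show "AE y in completion M. indicator {x} y * ?h x \<le> ?h y"
      using nonneg by eventually_elim (auto simp: indicator_def)
  qed
  also have "\<dots> = (sec_norm M f)\<^sup>2"
    using integral_nonneg_AE[OF nonneg] by (simp add: sec_norm_def)
  finally show ?thesis .
qed

lemma measure_atom_pos: "x \<in> atoms M \<Longrightarrow> 0 < measure M {x}"
  using emeasure_singleton_finite[of x]
  by (auto simp: atoms_def measure_def enn2real_positive_iff zero_less_iff_neq_zero)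

section \<open>Invariant antilinear operators\<close>

text \<open>The section \<open>e\<close> at \<open>a\<close> is a common eigenvector of the products
  \<open>gw_J\<close> after \<open>gw_J'\<close>. Antilinearity conjugates the purely imaginary
  eigenvalues, so \<open>T e\<close> can live only where all digits of \<open>a\<close> are flipped,
  and no atom is there.\<close>

lemma no_invariant_antilinear_orbit:
  assumes a: "a \<in> atoms M" and orbit: "\<And>x. x \<in> atoms M \<Longrightarrow> x \<oplus>\<^sub>2 a \<in> Delta"
  shows "\<not> invariant_antilinear M nu c T"
proof
  assume T: "invariant_antilinear M nu c T"
  define e where "e = point_section a"
  have e: "e \<in> sec_space M nu"
    unfolding e_def by (rule point_section_sec_space)
  have Te: "T e \<in> sec_space M nu"
    using T e unfolding invariant_antilinear_def by blast
  have flip: "T e x = (\<lambda>i. 0) \<or> x k \<noteq> a k" if x: "x \<in> atoms M" for x k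
  proof -
    \<comment> \<open>The eigenvalue of \<open>e\<close> for index \<open>k\<close>, namely the
      value of the diagonal operator at \<open>a\<close>.\<close>
    define z where "z = (if a k then - \<i> else \<i>)"
    let ?JJe = "gw_J M c k (gw_J' M c k e)"
    have J': "gw_J' M c k e \<in> sec_space M nu"
      using e by (rule gw_J'_sec_space)
    \<comment> \<open>The combination with second coefficient 0 expresses the multiple of
      \<open>e\<close> by \<open>z\<close>.\<close>
    have "sec_eq M ?JJe (sec_lin z e 0 e)"
      unfolding sec_eq_iff
    proof
      fix y assume y: "y \<in> atoms M"
      show "?JJe y = sec_lin z e 0 e y"
        unfolding gw_J_gw_J'[of y e k, OF y sec_spaceD[OF e y]]
        by (auto simp: sec_lin_def z_def e_def point_section_def)
    qed
    then have "sec_eq M (T ?JJe) (T (sec_lin z e 0 e))"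
      using T gw_J_sec_space[OF J'] sec_space_lin[OF e e] unfolding invariant_antilinear_def by blast
    moreover have "sec_eq M (T (sec_lin z e 0 e)) (sec_lin (cnj z) (T e) (cnj 0) (T e))"
      using T e unfolding invariant_antilinear_def by blast
    moreover have "sec_eq M (T ?JJe) (gw_J M c k (T (gw_J' M c k e)))"
      using T J' unfolding invariant_antilinear_def by blast
    moreover have "sec_eq M (gw_J M c k (T (gw_J' M c k e))) (gw_J M c k (gw_J' M c k (T e)))"
      by (rule gw_J_cong) (use T e in \<open>unfold invariant_antilinear_def, blast\<close>)
    ultimately have "gw_J M c k (gw_J' M c k (T e)) x = (\<lambda>i. cnj z * T e x i)"
      using x by (simp add: sec_eq_iff sec_lin_def)
    then have "(if x k then - \<i> else \<i>) * T e x i = cnj z * T e x i" for i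
      unfolding gw_J_gw_J'[of x "T e" k, OF x sec_spaceD[OF Te x]] by (rule fun_cong)
    \<comment> \<open>With equal digits the diagonal value is \<open>z\<close>, which differs from
      \<open>cnj z\<close>.\<close>
    then have "T e x i = 0" if "x k = a k" for i
      using that by (auto simp: z_def split: if_splits)
    then show ?thesis by blast
  qed
  have "T e x = (\<lambda>i. 0)" if x: "x \<in> atoms M" for x
  proof (rule ccontr)
    assume "T e x \<noteq> (\<lambda>i. 0)"
    \<comment> \<open>Every digit of \<open>x\<close> differs from that of \<open>a\<close>; the
      constant sequence of ones has infinite support.\<close>
    then have "x \<oplus>\<^sub>2 a = (\<lambda>n. True)"
      using flip[OF x] by (auto simp: bplus_def)
    then show False
      using orbit[OF x] by (simp add: Delta_def)
  qed
  then have "AE x in completion M. (\<Sum>i. (cmod (T e x i))\<^sup>2) = 0"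
    by (intro AE_completion) (simp add: AE_iff_atoms)
  then have "sec_norm M (T e) = 0"
    by (simp add: sec_norm_def integral_eq_zero_AE)
  then have "sec_norm M e = 0"
    using T e unfolding invariant_antilinear_def by metis
  \<comment> \<open>Coordinate 0 of \<open>e\<close> at \<open>a\<close> is 1 and \<open>a\<close>
    has positive mass, so the norm of \<open>e\<close> cannot vanish.\<close>
  then show False
    using norm_at_atom_le[OF e a, of 0] measure_atom_pos[OF a]
    by (simp add: e_def point_section_def hbasis_def)
qed

text \<open>Sections vanishing off the orbit of \<open>a\<close> form a closed invariant subspace.
  It contains the point section at \<open>a\<close>, and would miss the one at an atom
  \<open>b\<close> of another orbit.\<close>

lemma irreducible_single_orbit:
  assumes irr: "gw_irreducible M nu c" and a: "a \<in> atoms M" and b: "b \<in> atoms M"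
  shows "b \<oplus>\<^sub>2 a \<in> Delta"
proof (rule ccontr)
  assume nb: "b \<oplus>\<^sub>2 a \<notin> Delta"
  define S where
    "S = {f \<in> sec_space M nu. \<forall>x\<in>atoms M. x \<oplus>\<^sub>2 a \<notin> Delta \<longrightarrow> f x = (\<lambda>i. 0)}"
  have shift: "x \<oplus>\<^sub>2 delta k \<oplus>\<^sub>2 a \<in> Delta \<longleftrightarrow> x \<oplus>\<^sub>2 a \<in> Delta" for x k
  proof -
    have "x \<oplus>\<^sub>2 delta k \<oplus>\<^sub>2 a = x \<oplus>\<^sub>2 a \<oplus>\<^sub>2 delta k"
      by (auto simp: bplus_def)
    then show ?thesis by simp
  qed
  have "closed_subspace M nu S"
    unfolding closed_subspace_def
  proof (intro conjI allI ballI impI)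
    fix F and g :: vsec
    assume g: "g \<in> sec_space M nu"
      and F: "(\<forall>n. F n \<in> S) \<and> (\<lambda>n::nat. sec_norm M (sec_lin 1 (F n) (- 1) g)) \<longlonglongrightarrow> 0"
    have "g x i = 0" if x: "x \<in> atoms M" and nx: "x \<oplus>\<^sub>2 a \<notin> Delta" for x i
    proof -
      \<comment> \<open>Since \<open>F n\<close> vanishes at \<open>x\<close>, the difference has
        the value of \<open>- g\<close> there, and evaluation at the atom is bounded by the
        norm.\<close>
      have "(cmod (g x i))\<^sup>2 * measure M {x} \<le> (sec_norm M (sec_lin 1 (F n) (- 1) g))\<^sup>2" for n
      proof -
        have Fn: "F n \<in> sec_space M nu" "F n x = (\<lambda>i. 0)"
          using F x nx by (auto simp: S_def)
        show ?thesis
          using norm_at_atom_le[OF sec_space_lin[OF Fn(1) g] x, of 1 "-1" i] Fn(2)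
          by (simp add: sec_lin_def)
      qed
      moreover have "(\<lambda>n. (sec_norm M (sec_lin 1 (F n) (- 1) g))\<^sup>2) \<longlonglongrightarrow> 0\<^sup>2"
        using F by (intro tendsto_power) auto
      ultimately have "(cmod (g x i))\<^sup>2 * measure M {x} \<le> 0\<^sup>2"
        by (intro LIMSEQ_le_const[where X = "\<lambda>n. (sec_norm M (sec_lin 1 (F n) (- 1) g))\<^sup>2"]) blast+
      then show ?thesis
        using measure_atom_pos[OF x] by (simp add: mult_le_0_iff)
    qed
    then show "g \<in> S"
      using g by (auto simp: S_def)
  qed (auto simp: S_def sec_space_zero sec_space_lin, auto simp: sec_zero_def sec_lin_def)
  moreover have "gw_J M c k f \<in> S \<and> gw_J' M c k f \<in> S" if f: "f \<in> S" for k f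
  proof -
    have "gw_shift M c k f x i = 0" if "x \<in> atoms M" "x \<oplus>\<^sub>2 a \<notin> Delta" for x i
      using that f by (intro gw_shift_zero) (auto simp: S_def shift)
    then have "gw_J M c k f x = (\<lambda>i. 0)" "gw_J' M c k f x = (\<lambda>i. 0)"
      if "x \<in> atoms M" "x \<oplus>\<^sub>2 a \<notin> Delta" for x
      using that by (simp_all add: gw_J_def gw_J'_def)
    then show ?thesis
      using f by (simp add: S_def gw_J_sec_space gw_J'_sec_space)
  qed
  ultimately consider "S = {f \<in> sec_space M nu. sec_eq M f sec_zero}" | "S = sec_space M nu"
    using irr unfolding gw_irreducible_def by blast
  then show False
  proof cases
    case 1
    have "a \<oplus>\<^sub>2 a \<in> Delta"
      by (simp add: bplus_def Delta_def)
    then have "point_section a \<in> S"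
      by (auto simp: S_def point_section_sec_space) (auto simp: point_section_def)
    then have "sec_eq M (point_section a) sec_zero"
      using 1 by blast
    then show False
      using a point_section_nonzero[of a] by (simp add: sec_eq_iff sec_zero_def)
  next
    case 2
    then have "point_section b \<in> S"
      using point_section_sec_space by blast
    then show False
      using b nb point_section_nonzero[of b] by (simp add: S_def)
  qed
qed

text \<open>Irreducibility supplies a nonzero section, hence an atom to serve as base point, and
  places all atoms in its orbit.\<close>

lemma irreducible_no_invariant_antilinear:
  assumes "gw_irreducible M nu c"
  shows "\<not> invariant_antilinear M nu c T"
proof -
  obtain f where "\<not> sec_eq M f sec_zero"
    using assms unfolding gw_irreducible_def by blast
  then obtain a where "a \<in> atoms M"
    by (auto simp: sec_eq_iff)
  then show ?thesis
    using irreducible_single_orbit[OF assms] by (intro no_invariant_antilinear_orbit) auto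
qed

end

section \<open>The Fermi--Fock representation\<close>

lemma sets_mu_Delta: "sets mu_Delta = sets borel"
  by (simp add: mu_Delta_def)

lemma emeasure_mu_Delta:
  "B \<in> sets borel \<Longrightarrow> emeasure mu_Delta B = emeasure (count_space Delta) (B \<inter> Delta)"
  unfolding mu_Delta_def by (subst emeasure_distr) (auto simp: vimage_def)

lemma emeasure_mu_Delta_eq_0_iff: "B \<in> sets borel \<Longrightarrow> emeasure mu_Delta B = 0 \<longleftrightarrow> B \<inter> Delta = {}"
  by (simp add: emeasure_mu_Delta emeasure_count_space_eq_0)

lemma Delta_borel: "Delta \<in> sets borel"
  using countable_Delta by (rule sets.countable[rotated]) simp

text \<open>The points of \<open>Delta\<close> have mass 1 and its complement has mass 0; together
  they form a countable cover.\<close>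

lemma sigma_finite_mu_Delta: "sigma_finite_measure mu_Delta"
proof
  show "\<exists>A. countable A \<and> A \<subseteq> sets mu_Delta \<and> \<Union> A = space mu_Delta \<and>
      (\<forall>a\<in>A. emeasure mu_Delta a \<noteq> \<infinity>)"
  proof (intro exI[of _ "insert (- Delta) ((\<lambda>x. {x}) ` Delta)"] conjI ballI)
    fix B assume "B \<in> insert (- Delta) ((\<lambda>x. {x}) ` Delta)"
    then show "emeasure mu_Delta B \<noteq> \<infinity>"
      using Delta_borel by (auto simp: emeasure_mu_Delta borel_comp)
  qed (use countable_Delta Delta_borel in \<open>auto simp: sets_mu_Delta mu_Delta_def\<close>)
qed

text \<open>Null sets are the Borel sets disjoint from \<open>Delta\<close>, and translation by an
  element of \<open>Delta\<close> permutes \<open>Delta\<close>.\<close>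

lemma quasi_invariant_mu_Delta: "quasi_invariant mu_Delta"
proof -
  have "null_sets (translate d mu_Delta) = null_sets mu_Delta" if d: "d \<in> Delta" for d
  proof -
    have "emeasure (translate d mu_Delta) B = 0 \<longleftrightarrow> emeasure mu_Delta B = 0" if B: "B \<in> sets borel" for B
    proof -
      let ?B = "(\<lambda>x. x \<oplus>\<^sub>2 d) -` B"
      have sB: "?B \<in> sets borel"
        using measurable_sets[OF measurable_bplus B] by simp
      have "emeasure (translate d mu_Delta) B = emeasure mu_Delta ?B"
        unfolding translate_def using B
        by (subst emeasure_distr)
          (auto simp: measurable_cong_sets[OF sets_mu_Delta refl] mu_Delta_def)
      moreover have "?B \<inter> Delta = {} \<longleftrightarrow> B \<inter> Delta = {}"
        using d by (auto simp: disjoint_iff) (metis bplus_cancel bplus_in_Delta_iff)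
      ultimately show ?thesis
        by (simp add: emeasure_mu_Delta_eq_0_iff B sB)
    qed
    then show ?thesis
      by (auto simp: null_sets_def sets_mu_Delta translate_def)
  qed
  then show ?thesis
    by (simp add: quasi_invariant_def absolutely_continuous_def)
qed

lemma gw_triple_Fock: "gw_triple mu_Delta (\<lambda>x. 1) (\<lambda>k x v. v)"
  unfolding gw_triple_def
  using sigma_finite_mu_Delta quasi_invariant_mu_Delta
  by (auto simp: sets_mu_Delta hunitary_def hadjoint_def)

lemma discrete_mu_Delta: "discrete_measure mu_Delta"
  unfolding discrete_measure_def
proof (intro exI[of _ Delta] conjI)
  have "- Delta \<in> null_sets mu_Delta"
    using Delta_borel
    by (auto simp: null_sets_def sets_mu_Delta emeasure_mu_Delta_eq_0_iff borel_comp)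
  then show "AE x in mu_Delta. x \<in> Delta"
    using AE_not_in by fastforce
qed (rule countable_Delta)

lemma atoms_mu_Delta: "atoms mu_Delta = Delta"
  by (auto simp: atoms_def emeasure_mu_Delta_eq_0_iff)

theorem corollary3p11:
  shows "(\<forall>M nu c. gw_triple M nu c \<and> discrete_measure M \<and> gw_irreducible M nu c \<longrightarrow>
            (\<nexists>T. invariant_quaternionic_structure M nu c T)) \<and>
         complex_type mu_Delta (\<lambda>x. 1) (\<lambda>k x v. v)"
proof (intro conjI allI impI)
  fix M nu c
  assume A: "gw_triple M nu c \<and> discrete_measure M \<and> gw_irreducible M nu c"
  then interpret discrete_gw M nu c
    by unfold_locales auto
  show "\<nexists>T. invariant_quaternionic_structure M nu c T"
    using A irreducible_no_invariant_antilinear by (auto simp: invariant_quaternionic_structure_def)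
next
  interpret discrete_gw mu_Delta "\<lambda>x. 1" "\<lambda>k x v. v"
    by unfold_locales (rule gw_triple_Fock, rule discrete_mu_Delta)
  have "(\<lambda>n. False) \<in> Delta"
    by (simp add: Delta_def)
  \<comment> \<open>The atoms are exactly \<open>Delta\<close>, the orbit of the zero sequence, so
    the orbit condition is immediate with that base point.\<close>
  then have "\<not> invariant_antilinear mu_Delta (\<lambda>x. 1) (\<lambda>k x v. v) T" for T
    by (intro no_invariant_antilinear_orbit[of "\<lambda>n. False"]) (simp_all add: atoms_mu_Delta)
  then show "complex_type mu_Delta (\<lambda>x. 1) (\<lambda>k x v. v)"
    by (simp add: complex_type_def invariant_real_structure_def invariant_quaternionic_structure_def)
qed

end
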